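(* Let $\mathcal D$ be a doctrine on a finite set of literals $\Pi$, and let $w$ be a valuation that is consistent with $\mathcal D$, i.e. $w'=w$. Then for every $\eta$ with $0\le\eta\le1$ the decision of margin $\eta$ associated with $w$, that is, the partial truth assignment $\mu_\eta(w)$, is definitely consistent with $\mathcal D$.
   Context: $\Pi_+$ is a finite nonempty set of atoms; $\Pi=\bigcup_{p\in\Pi_+}\{p,\overline p\}$ is the set of literals, where $p\mapsto\overline p$ is negation and $\overline{\overline p}=p$. A clause is a subset $C\subseteq\Pi$, read as the disjunction $\bigvee_{p\in C}p$. A doctrine is a collection $\mathcal D$ of clauses, read as the conjunctive normal form $\bigwedge_{C\in\mathcal D}\bigvee_{p\in C}p$. Standing assumptions: (D1) this formula is satisfiable; (D2) no clause in $\mathcal D$ consists of a single literal; (D3) $\{p,\overline p\}\in\mathcal D$ for every $p\in\Pi_+$. A valuation is a map $w:\Pi\to[0,1]$, $p\mapsto w_p$. For a valuation $w$ define $w'$ by $$w'_p=\max_{C\in\mathcal D,\ C\ni p}\ \min_{\alpha\in C,\ \alpha\neq p} w_{\overline\alpha}.$$ A partial truth assignment is a valuation $u$ with values in $\{0,\tfrac12,1\}$ and $u_p+u_{\overline p}=1$ for all $p$ (values $1,0,\tfrac12$ mean accepted, rejected, undecided). It is definitely consistent with $\mathcal D$ when, for each $C\in\mathcal D$ and every $p\in C$: if $u_\alpha=0$ for every $\alpha\in C\setminus\{p\}$, then $u_p=1$. For a valuation $w$ and $0\le\eta\le1$, the decision of margin $\eta$ is the partial truth assignment $\mu_\eta(w)$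 with, for each $p\in\Pi$: $\mu_\eta(w)_p=1$ and $\mu_\eta(w)_{\overline p}=0$ if $w_p-w_{\overline p}>\eta$; $\mu_\eta(w)_p=\mu_\eta(w)_{\overline p}=\tfrac12$ if $|w_p-w_{\overline p}|\le\eta$. *)

theory Defs
  imports Complex_Main
begin

datatype 'a lit = Pos 'a | Neg 'a

primrec negate :: "'a lit \<Rightarrow> 'a lit" where
  "negate (Pos a) = Neg a"
| "negate (Neg a) = Pos a"

definition literals :: "'a set \<Rightarrow> 'a lit set" where
  "literals A = (\<Union>p \<in> Pos ` A. {p, negate p})"

primrec lit_true :: "('a \<Rightarrow> bool) \<Rightarrow> 'a lit \<Rightarrow> bool" where
  "lit_true T (Pos a) \<longleftrightarrow> T a"
| "lit_true T (Neg a) \<longleftrightarrow> \<not> T a"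

definition satisfiable :: "'a lit set set \<Rightarrow> bool" where
  "satisfiable D \<longleftrightarrow> (\<exists>T. \<forall>C\<in>D. \<exists>p\<in>C. lit_true T p)"

definition doctrine :: "'a set \<Rightarrow> 'a lit set set \<Rightarrow> bool" where
  "doctrine A D \<longleftrightarrow>
     (\<forall>C\<in>D. C \<subseteq> literals A) \<and>
     satisfiable D \<and>
     (\<forall>C\<in>D. \<not> is_singleton C) \<and>
     (\<forall>p \<in> Pos ` A. {p, negate p} \<in> D)"

text \<open>Valuations live on the literals over the set \<open>A\<close> of atoms; a function representing
  one is unconstrained, and never consulted, elsewhere.\<close>

definition valuation :: "'a set \<Rightarrow> ('a lit \<Rightarrow> real) \<Rightarrow> bool" where
  "valuation A w \<longleftrightarrow> (\<forall>p\<in>literals A. 0 \<le> w p \<and> w p \<le> 1)"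

text \<open>For a doctrine over a finite set of atoms and \<open>p\<close> one of its literals, the sets under
  \<open>Max\<close> and \<open>Min\<close> are finite and nonempty: \<open>p\<close> lies in the clause consisting of \<open>p\<close> and its
  negation, and no clause is a singleton.\<close>

definition revise :: "'a lit set set \<Rightarrow> ('a lit \<Rightarrow> real) \<Rightarrow> 'a lit \<Rightarrow> real" where
  "revise D w p = Max ((\<lambda>C. Min ((\<lambda>\<alpha>. w (negate \<alpha>)) ` (C - {p}))) ` {C \<in> D. p \<in> C})"

definition consistent :: "'a set \<Rightarrow> 'a lit set set \<Rightarrow> ('a lit \<Rightarrow> real) \<Rightarrow> bool" where
  "consistent A D w \<longleftrightarrow> (\<forall>p\<in>literals A. revise D w p = w p)"

definition partial_truth_assignment :: "'a set \<Rightarrow> ('a lit \<Rightarrow> real) \<Rightarrow> bool" where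
  "partial_truth_assignment A u \<longleftrightarrow>
     (\<forall>p\<in>literals A. u p \<in> {0, 1/2, 1} \<and> u p + u (negate p) = 1)"

definition definitely_consistent :: "'a lit set set \<Rightarrow> ('a lit \<Rightarrow> real) \<Rightarrow> bool" where
  "definitely_consistent D u \<longleftrightarrow>
     (\<forall>C\<in>D. \<forall>p\<in>C. (\<forall>\<alpha>\<in>C - {p}. u \<alpha> = 0) \<longrightarrow> u p = 1)"

definition decision :: "real \<Rightarrow> ('a lit \<Rightarrow> real) \<Rightarrow> 'a lit \<Rightarrow> real" where
  "decision \<eta> w p =
     (if w p - w (negate p) > \<eta> then 1
      else if w (negate p) - w p > \<eta> then 0
      else 1/2)"

end

theory Submission
  imports Defs
begin

text \<open>Suppose every literal of a clause \<open>C\<close> other than \<open>p\<close> is rejected, and let \<open>\<alpha>\<close> be one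
  of them whose negation has the least value. The fixed-point equation at \<open>p\<close> gives
  \<open>w p \<ge> w (negate \<alpha>)\<close>. The fixed-point equation at \<open>\<alpha>\<close> bounds \<open>w \<alpha>\<close> from below by the
  value of \<open>negate \<beta>\<close> for some other \<open>\<beta>\<close> in \<open>C\<close>; as \<open>w \<alpha> < w (negate \<alpha>)\<close>, minimality
  of \<open>\<alpha>\<close> forces \<open>\<beta> = p\<close>. So \<open>w p - w (negate p) \<ge> w (negate \<alpha>) - w \<alpha> > \<eta>\<close>.\<close>

lemma negate_negate [simp]: "negate (negate p) = p"
  by (cases p) auto

lemma finite_literals: "finite A \<Longrightarrow> finite (literals A)"
  by (simp add: literals_def)

lemma partial_truth_assignment_decision:
  "0 \<le> \<eta> \<Longrightarrow> partial_truth_assignment A (decision \<eta> w)"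
  by (auto simp: partial_truth_assignment_def decision_def)

lemma decision_eq_0_iff: "0 \<le> \<eta> \<Longrightarrow> decision \<eta> w p = 0 \<longleftrightarrow> w (negate p) - w p > \<eta>"
  by (auto simp: decision_def)

text \<open>The maximum defining \<open>revise D w p\<close> dominates the entry of
  \<open>C\<close>, a minimum attained at some \<open>\<alpha>\<close>. The theorem applies this
  twice to one clause, at \<open>p\<close> and at the resulting \<open>\<alpha>\<close>.\<close>

lemma consistent_clause_le:
  assumes "finite A" "doctrine A D" "consistent A D w" "C \<in> D" "p \<in> C"
  obtains \<alpha> where "\<alpha> \<in> C - {p}" "w (negate \<alpha>) \<le> w p"
    "\<And>\<beta>. \<beta> \<in> C - {p} \<Longrightarrow> w (negate \<alpha>) \<le> w (negate \<beta>)"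
proof -
  let ?m = "\<lambda>C. Min ((\<lambda>\<alpha>. w (negate \<alpha>)) ` (C - {p}))"
  have sub: "D \<subseteq> Pow (literals A)" and "C \<subseteq> literals A" and ns: "\<not> is_singleton C"
    using assms by (auto simp: doctrine_def)
  have "finite D"
    using finite_subset[OF sub] finite_literals[OF \<open>finite A\<close>] by simp
  then have "?m C \<le> revise D w p"
    unfolding revise_def using assms by (intro Max_ge) auto
  also have "\<dots> = w p"
    using assms \<open>C \<subseteq> literals A\<close> by (auto simp: consistent_def)
  finally have le: "?m C \<le> w p" .
  have fin: "finite (C - {p})"
    using \<open>C \<subseteq> literals A\<close> finite_literals[OF \<open>finite A\<close>] finite_subset by blast
  \<comment> \<open>The exclusion of one-literal clauses is what makes the minimum attained.\<close>
  have ne: "C - {p} \<noteq> {}"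
    using ns \<open>p \<in> C\<close> by (auto simp: is_singleton_def)
  have "?m C \<in> (\<lambda>\<alpha>. w (negate \<alpha>)) ` (C - {p})"
    using fin ne by (intro Min_in) auto
  then obtain \<alpha> where \<alpha>: "\<alpha> \<in> C - {p}" "?m C = w (negate \<alpha>)"
    by blast
  have "w (negate \<alpha>) \<le> w (negate \<beta>)" if "\<beta> \<in> C - {p}" for \<beta>
    unfolding \<alpha>(2)[symmetric] using fin that by (intro Min_le) auto
  with \<alpha> le show thesis by (intro that) auto
qed

theorem theorem3p6:
  fixes A :: "'a set" and D :: "'a lit set set" and w :: "'a lit \<Rightarrow> real" and \<eta> :: real
  assumes "finite A" and "A \<noteq> {}"
    and "doctrine A D"
    and "valuation A w"
    and "consistent A D w"
    and "0 \<le> \<eta>" and "\<eta> \<le> 1"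
  shows "partial_truth_assignment A (decision \<eta> w) \<and> definitely_consistent D (decision \<eta> w)"
proof
  show "partial_truth_assignment A (decision \<eta> w)"
    using \<open>0 \<le> \<eta>\<close> by (rule partial_truth_assignment_decision)
  show "definitely_consistent D (decision \<eta> w)"
    unfolding definitely_consistent_def
  proof (intro ballI impI)
    fix C p
    assume C: "C \<in> D" and p: "p \<in> C" and "\<forall>\<alpha>\<in>C - {p}. decision \<eta> w \<alpha> = 0"
    then have rejected: "\<eta> < w (negate \<alpha>) - w \<alpha>" if "\<alpha> \<in> C - {p}" for \<alpha>
      using that \<open>0 \<le> \<eta>\<close> decision_eq_0_iff by blast
    note clause = consistent_clause_le[OF \<open>finite A\<close> \<open>doctrine A D\<close> \<open>consistent A D w\<close> C]
    obtain \<alpha> where \<alpha>: "\<alpha> \<in> C - {p}" "w (negate \<alpha>) \<le> w p"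
        and least: "\<And>\<beta>. \<beta> \<in> C - {p} \<Longrightarrow> w (negate \<alpha>) \<le> w (negate \<beta>)"
      using clause[OF p] by blast
    obtain \<beta> where \<beta>: "\<beta> \<in> C - {\<alpha>}" "w (negate \<beta>) \<le> w \<alpha>"
      using clause[of \<alpha>] \<alpha>(1) by blast
    \<comment> \<open>Otherwise \<open>least\<close> gives \<open>w (negate \<alpha>) \<le> w
      (negate \<beta>) \<le> w \<alpha>\<close>, while rejection with \<open>0 \<le> \<eta>\<close>
      makes \<open>w \<alpha>\<close> strictly smaller.\<close>
    have "\<beta> = p"
      using least[of \<beta>] \<beta> rejected[OF \<alpha>(1)] \<open>0 \<le> \<eta>\<close> by force
    then have "\<eta> < w p - w (negate p)"
      using \<alpha>(2) \<beta>(2) rejected[OF \<alpha>(1)] by simp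
    then show "decision \<eta> w p = 1"
      by (simp add: decision_def)
  qed
qed

end
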